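(* Let $x,y$ be complex numbers with $|x|<1$ and $|y|<1$. Then, with all products taken over all pairs of positive integers $a,b\ge 1$ with $\gcd(a,b)=1$, \[ \prod_{\substack{a,b\ge1\\ \gcd(a,b)=1}}\left(1-x^ay^b\right)^{-a^{-1}}=\left(\frac{1}{1-x}\right)^{\frac{y}{1-y}}, \qquad \prod_{\substack{a,b\ge1\\ \gcd(a,b)=1}}\left(1-x^ay^b\right)^{-a^{-2}b}=\exp\!\left(\mathrm{Li}_2(x)\frac{y}{(1-y)^2}\right), \] \[ \prod_{\substack{a,b\ge1\\ \gcd(a,b)=1}}\left(1-x^ay^b\right)^{-a^{-3}b^{2}}=\exp\!\left(\mathrm{Li}_3(x)\frac{y(1+y)}{(1-y)^3}\right), \qquad \prod_{\substack{a,b\ge1\\ \gcd(a,b)=1}}\left(1-x^ay^b\right)^{-a^{-4}b^{3}}=\exp\!\left(\mathrm{Li}_4(x)\frac{y(1+4y+y^2)}{(1-y)^4}\right), \] \[ \prod_{\substack{a,b\ge1\\ \gcd(a,b)=1}}\left(1-x^ay^b\right)^{-a^{-5}b^{4}}=\exp\!\left(\mathrm{Li}_5(x)\frac{y(1+y)(1+10y+y^2)}{(1-y)^5}\right). \]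
   Context: For complex $s$ and $|z|<1$, the polylogarithm is $\mathrm{Li}_s(z)=\sum_{k=1}^\infty z^k/k^s$. For $|w|<1$ and complex $c$, the power $(1-w)^{c}$ means $\exp(c\log(1-w))$ with the principal branch of the logarithm, and $(1/(1-x))^{\beta}=\exp(-\beta\log(1-x))$; the infinite products are understood as the exponential of the (absolutely convergent) sum of the logarithms of the factors. *)

theory Defs
  imports "HOL-Analysis.Analysis"
begin

definition polylog :: "complex \<Rightarrow> complex \<Rightarrow> complex" where
  "polylog s z = (\<Sum>k. z ^ Suc k / of_nat (Suc k) powr s)"

definition coprime_pairs :: "(nat \<times> nat) set" where
  "coprime_pairs = {(a, b). 1 \<le> a \<and> 1 \<le> b \<and> coprime a b}"

text \<open>
  The unordered product of the powers \<open>(1 - x\<^sup>a y\<^sup>b) powr c a b\<close> over all pairs of coprime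
  positive integers equals \<open>P\<close>, the product being the exponential of the sum of the logarithms
  \<open>c a b * Ln (1 - x\<^sup>a y\<^sup>b)\<close> of its factors. Absolute convergence of that sum is part of the
  predicate, since \<^const>\<open>infsum\<close> is 0 for families that are not summable.
\<close>

definition has_coprime_prod ::
    "complex \<Rightarrow> complex \<Rightarrow> (nat \<Rightarrow> nat \<Rightarrow> complex) \<Rightarrow> complex \<Rightarrow> bool" where
  "has_coprime_prod x y c P \<longleftrightarrow>
     (\<lambda>(a, b). norm (c a b * Ln (1 - x ^ a * y ^ b))) summable_on coprime_pairs \<and>
     exp (\<Sum>\<^sub>\<infinity>(a, b)\<in>coprime_pairs. c a b * Ln (1 - x ^ a * y ^ b)) = P"

end

theory Submission
  imports Defs
begin

text \<open>
  Expanding \<open>- Ln (1 - x\<^sup>a y\<^sup>b) = (\<Sum>k\<ge>1. x\<^sup>k\<^sup>a y\<^sup>k\<^sup>b / k)\<close>, the logarithm of the product with exponents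
  \<open>- b\<^sup>m / a\<^sup>m\<^sup>+\<^sup>1\<close> becomes a sum over coprime \<open>(a, b)\<close> and \<open>k \<ge> 1\<close> whose term depends only on
  \<open>(p, q) = (k a, k b)\<close>, namely \<open>(x\<^sup>p / p\<^sup>m\<^sup>+\<^sup>1) (q\<^sup>m y\<^sup>q)\<close>. Every pair of positive integers is of this form
  exactly once, so the sum factors as \<open>Li\<^sub>m\<^sub>+\<^sub>1(x)\<close> times \<open>\<Sum>q\<ge>1. q\<^sup>m y\<^sup>q\<close>, a rational function of \<open>y\<close>.
\<close>

section \<open>Power moments of the geometric series\<close>

text \<open>Termwise differentiation keeps a power series convergent in the open unit disc and turns
  the coefficients \<open>n ^ m\<close> into \<open>(n + 1) ^ (m + 1)\<close>, which is the
  induction step.\<close>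

lemma summable_of_nat_power_times_power:
  fixes z :: "'a::{real_normed_field,banach}"
  assumes "norm z < 1"
  shows "summable (\<lambda>n. of_nat (Suc n) ^ m * z ^ n)"
  using assms
proof (induction m arbitrary: z)
  case 0
  then show ?case by (simp add: summable_geometric)
next
  case (Suc m)
  \<comment> \<open>Differentiation requires unshifted coefficients and convergence on the whole
    disc, not only at \<open>z\<close>.\<close>
  have "summable (\<lambda>n. of_nat n ^ m * w ^ n)" if "norm w < 1" for w :: 'a
  proof -
    have "summable (\<lambda>n. w * (of_nat (Suc n) ^ m * w ^ n))"
      by (intro summable_mult Suc.IH that)
    then have "summable (\<lambda>n. of_nat (Suc n) ^ m * w ^ Suc n)"
      by (simp only: power_Suc mult.left_commute)
    then show ?thesis by (subst summable_Suc_iff [symmetric])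
  qed
  then have "summable (\<lambda>n. diffs (\<lambda>n. of_nat n ^ m) n * z ^ n)"
    using Suc.prems by (rule termdiff_converges [rotated])
  then show ?case by (simp add: diffs_def del: of_nat_Suc)
qed

text \<open>The index is shifted because \<open>0 ^ 0 = 1\<close> would add a spurious term at \<open>m = 0\<close>;
  the series \<open>\<Sum>q\<ge>1. q\<^sup>m z\<^sup>q\<close> is \<open>z * power_moment m z\<close>.\<close>

definition power_moment :: "nat \<Rightarrow> complex \<Rightarrow> complex" where
  "power_moment m z = (\<Sum>n. of_nat (Suc n) ^ m * z ^ n)"

lemma power_moment_sums:
  assumes "norm z < 1"
  shows "(\<lambda>n. of_nat (Suc n) ^ m * z ^ n) sums power_moment m z"
  unfolding power_moment_def
  by (intro summable_sums summable_of_nat_power_times_power assms)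

text \<open>Expand \<open>(n + 2) ^ m = ((n + 1) + 1) ^ m\<close> by the binomial theorem and sum
  over \<open>n\<close>. Moving the term \<open>j = m\<close> to the left gives the factor
  \<open>1 - z\<close>, so each moment is determined by the lower ones.\<close>

lemma power_moment_rec:
  assumes "norm z < 1"
  shows "(1 - z) * power_moment m z = 1 + z * (\<Sum>j<m. of_nat (m choose j) * power_moment j z)"
proof -
  have "(\<lambda>n. z * (\<Sum>j\<le>m. of_nat (m choose j) * (of_nat (Suc n) ^ j * z ^ n)))
          sums (z * (\<Sum>j\<le>m. of_nat (m choose j) * power_moment j z))"
    by (intro sums_mult sums_sum power_moment_sums assms)
  moreover have "z * (\<Sum>j\<le>m. of_nat (m choose j) * (of_nat (Suc n) ^ j * z ^ n))
      = of_nat (Suc (Suc n)) ^ m * z ^ Suc n" for n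
    using binomial_ring [of "of_nat (Suc n) :: complex" 1 m]
    by (simp add: sum_distrib_left sum_distrib_right algebra_simps)
  ultimately have "(\<lambda>n. of_nat (Suc (Suc n)) ^ m * z ^ Suc n)
      sums (z * (\<Sum>j\<le>m. of_nat (m choose j) * power_moment j z))"
    by (simp only:)
  from sums_Suc [OF this]
  have "power_moment m z = z * (\<Sum>j\<le>m. of_nat (m choose j) * power_moment j z) + 1"
    using sums_unique2 [OF power_moment_sums [OF assms, of m]] by simp
  also have "(\<Sum>j\<le>m. of_nat (m choose j) * power_moment j z)
      = (\<Sum>j<m. of_nat (m choose j) * power_moment j z) + power_moment m z"
    by (simp add: lessThan_Suc_atMost [symmetric])
  finally show ?thesis by (simp add: algebra_simps)
qed

text \<open>The numerators are the Eulerian polynomials; the last one is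
  \<open>1 + 11 * z + 11 * z ^ 2 + z ^ 3\<close> in factored form.\<close>

lemma power_moment_closed_forms:
  assumes "norm z < 1"
  shows "power_moment 0 z = 1 / (1 - z)"
    and "power_moment 1 z = 1 / (1 - z) ^ 2"
    and "power_moment 2 z = (1 + z) / (1 - z) ^ 3"
    and "power_moment 3 z = (1 + 4 * z + z ^ 2) / (1 - z) ^ 4"
    and "power_moment 4 z = (1 + z) * (1 + 10 * z + z ^ 2) / (1 - z) ^ 5"
proof -
  \<comment> \<open>In terms of \<open>w\<close> all denominators are monomials, so each case
    reduces to a polynomial identity.\<close>
  define w where "w = 1 - z"
  have w: "w \<noteq> 0" and z: "z = 1 - w" using assms by (auto simp: w_def)
  note rec = power_moment_rec [OF assms, folded w_def]
  have iff: "w * p = q \<longleftrightarrow> p = q / w" for p q using w by (auto simp: field_simps)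
  have 0: "power_moment 0 z = 1 / w"
    using rec [of 0] by (simp add: iff)
  have "power_moment 1 z = (1 + z * (1 / w)) / w"
    using rec [of 1] by (simp add: iff 0)
  also have "\<dots> = 1 / w ^ 2"
    using w by (simp add: z field_simps eval_nat_numeral)
  finally have 1: "power_moment 1 z = 1 / w ^ 2" .
  have "{..<2} = {0, 1 :: nat}" by auto
  then have "power_moment 2 z = (1 + z * (1 / w + 2 / w ^ 2)) / w"
    using rec [of 2] by (simp add: iff 0 1 [simplified])
  also have "\<dots> = (1 + z) / w ^ 3"
    using w by (simp add: z field_simps eval_nat_numeral)
  finally have 2: "power_moment 2 z = (1 + z) / w ^ 3" .
  have "{..<3} = {0, 1, 2 :: nat}" by auto
  then have "power_moment 3 z = (1 + z * (1 / w + 3 / w ^ 2 + 3 * (1 + z) / w ^ 3)) / w"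
    using rec [of 3] by (simp add: iff 0 1 [simplified] 2 choose_two add.assoc)
  also have "\<dots> = (1 + 4 * z + z ^ 2) / w ^ 4"
    using w by (simp add: z field_simps eval_nat_numeral)
  finally have 3: "power_moment 3 z = (1 + 4 * z + z ^ 2) / w ^ 4" .
  have "{..<4} = {0, 1, 2, 3 :: nat}" by auto
  moreover have "4 choose 3 = (4 :: nat)" by (simp add: eval_nat_numeral)
  ultimately have "power_moment 4 z =
      (1 + z * (1 / w + 4 / w ^ 2 + 6 * (1 + z) / w ^ 3 + 4 * (1 + 4 * z + z ^ 2) / w ^ 4)) / w"
    using rec [of 4] by (simp add: iff 0 1 [simplified] 2 3 choose_two add.assoc)
  also have "\<dots> = (1 + z) * (1 + 10 * z + z ^ 2) / w ^ 5"
    using w by (simp add: z field_simps eval_nat_numeral)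
  finally have "power_moment 4 z = (1 + z) * (1 + 10 * z + z ^ 2) / w ^ 5" .
  with 0 1 2 3 show "power_moment 0 z = 1 / (1 - z)"
    and "power_moment 1 z = 1 / (1 - z) ^ 2"
    and "power_moment 2 z = (1 + z) / (1 - z) ^ 3"
    and "power_moment 3 z = (1 + 4 * z + z ^ 2) / (1 - z) ^ 4"
    and "power_moment 4 z = (1 + z) * (1 + 10 * z + z ^ 2) / (1 - z) ^ 5"
    by (simp_all add: w_def)
qed

section \<open>Unordered sums over positive integers\<close>

lemma has_sum_greaterThan_0:
  fixes f :: "nat \<Rightarrow> 'a::banach"
  assumes "summable (\<lambda>n. norm (f (Suc n)))" and "(\<lambda>n. f (Suc n)) sums S"
  shows "(f has_sum S) {0<..}"
proof -
  have "((\<lambda>n. f (Suc n)) has_sum S) UNIV"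
    using assms by (rule norm_summable_imp_has_sum)
  moreover have "bij_betw Suc UNIV {0<..}"
    by (auto simp: bij_betw_def image_iff gr0_conv_Suc)
  ultimately show ?thesis using has_sum_reindex_bij_betw by fast
qed

text \<open>The inverse divides by the gcd: \<open>gcd (k * a) (k * b) = k\<close> when
  \<open>a\<close> and \<open>b\<close> are coprime.\<close>

lemma bij_betw_coprime_pairs_scale:
  "bij_betw (\<lambda>((a, b), k). (k * a, k * b)) (coprime_pairs \<times> {0<..}) ({0<..} \<times> {0<..})"
  by (rule bij_betw_byWitness [where f' = "\<lambda>(p, q). ((p div gcd p q, q div gcd p q), gcd p q)"])
     (auto simp: coprime_pairs_def gcd_mult_distrib_nat [symmetric] div_gcd_coprime Suc_le_eq
        div_greater_zero_iff intro: dvd_imp_le)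

lemma polylog_has_sum:
  assumes "norm z < 1"
  shows "((\<lambda>p. z ^ p / of_nat p ^ m) has_sum polylog (of_nat m) z) {0<..}"
    and "(\<lambda>p. norm (z ^ p / of_nat p ^ m)) summable_on {0<..}"
proof -
  have "summable (\<lambda>k. norm z * norm z ^ k)"
    using assms by (intro summable_mult summable_geometric) simp
  then have summ: "summable (\<lambda>k. norm (z ^ Suc k / of_nat (Suc k) ^ m))"
  proof (rule summable_comparison_test' [where N = 0])
    fix k
    have "1 \<le> real (Suc k) ^ m" by (rule one_le_power) simp
    then have "norm z ^ Suc k / real (Suc k) ^ m \<le> norm z ^ Suc k / 1"
      by (intro divide_left_mono) auto
    then show "norm (norm (z ^ Suc k / of_nat (Suc k) ^ m)) \<le> norm z * norm z ^ k"
      by (simp add: norm_divide norm_mult norm_power del: of_nat_Suc)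
  qed
  \<comment> \<open>The base \<open>Suc k\<close> is nonzero, so the complex power in
    \<open>polylog\<close> is an ordinary one, even for \<open>m = 0\<close>.\<close>
  have "(\<lambda>k. z ^ Suc k / of_nat (Suc k) ^ m) sums polylog (of_nat m) z"
    using summable_sums [OF summable_norm_cancel [OF summ]]
    by (simp add: polylog_def powr_nat' del: of_nat_Suc)
  with summ show "((\<lambda>p. z ^ p / of_nat p ^ m) has_sum polylog (of_nat m) z) {0<..}"
    by (rule has_sum_greaterThan_0)
  show "(\<lambda>p. norm (z ^ p / of_nat p ^ m)) summable_on {0<..}"
    using has_sum_greaterThan_0 [OF _ summable_sums [OF summ]] summ
    unfolding summable_on_def by auto
qed

lemma polylog_1:
  assumes "norm z < 1"
  shows "polylog 1 z = - Ln (1 - z)"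
proof -
  have "(\<lambda>k. - (z ^ k) / of_nat k) sums Ln (1 - z)"
    using Ln_series' [of "- z"] assms by simp
  then have "(\<lambda>k. z ^ k / of_nat k) sums - Ln (1 - z)"
    using sums_minus by fastforce
  \<comment> \<open>The term at index 0 is \<open>1 / 0 = 0\<close>, so the shift does not change
    the sum.\<close>
  then have "(\<lambda>k. z ^ Suc k / of_nat (Suc k)) sums - Ln (1 - z)"
    by (subst sums_Suc_iff) simp
  then show ?thesis
    by (simp add: polylog_def sums_iff del: of_nat_Suc)
qed

lemma neg_Ln_one_minus_has_sum:
  assumes "norm z < 1"
  shows "((\<lambda>k. z ^ k / of_nat k) has_sum - Ln (1 - z)) {0<..}"
  using polylog_has_sum(1) [OF assms, of 1] polylog_1 [OF assms] by simp

lemma power_moment_has_sum: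
  assumes "norm z < 1"
  shows "((\<lambda>q. of_nat q ^ m * z ^ q) has_sum z * power_moment m z) {0<..}"
    and "(\<lambda>q. norm (of_nat q ^ m * z ^ q)) summable_on {0<..}"
proof -
  \<comment> \<open>This is the real instance of the convergence lemma, taken at
    \<open>norm z\<close>.\<close>
  have "summable (\<lambda>n. norm z * (of_nat (Suc n) ^ m * norm z ^ n))"
    using assms by (intro summable_mult summable_of_nat_power_times_power) simp
  then have summ: "summable (\<lambda>n. norm (of_nat (Suc n) ^ m * z ^ Suc n))"
    by (simp add: norm_mult norm_power mult.left_commute del: of_nat_Suc)
  have "(\<lambda>n. z * (of_nat (Suc n) ^ m * z ^ n)) sums (z * power_moment m z)"
    by (intro sums_mult power_moment_sums assms)
  then have "(\<lambda>n. of_nat (Suc n) ^ m * z ^ Suc n) sums (z * power_moment m z)"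
    by (simp add: mult.left_commute del: of_nat_Suc)
  with summ show "((\<lambda>q. of_nat q ^ m * z ^ q) has_sum z * power_moment m z) {0<..}"
    by (rule has_sum_greaterThan_0)
  show "(\<lambda>q. norm (of_nat q ^ m * z ^ q)) summable_on {0<..}"
    using has_sum_greaterThan_0 [OF _ summable_sums [OF summ]] summ
    unfolding summable_on_def by auto
qed

section \<open>Products over coprime pairs\<close>

lemma has_coprime_prod_polylog:
  assumes x: "norm x < 1" and y: "norm y < 1"
  shows "has_coprime_prod x y (\<lambda>a b. - (of_nat b ^ m / of_nat a ^ Suc m))
           (exp (polylog (of_nat (Suc m)) x * (y * power_moment m y)))"
proof -
  \<comment> \<open>\<open>F\<close> is the summand on all positive pairs, \<open>G\<close> its
    pullback to a coprime pair with a multiplier \<open>k\<close>, and \<open>L\<close> the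
    logarithm of one factor.\<close>
  define F where "F = (\<lambda>(p, q). x ^ p / of_nat p ^ Suc m * (of_nat q ^ m * y ^ q))"
  define G where "G = (\<lambda>t. F ((\<lambda>((a, b), k). (k * a, k * b)) t))"
  define L where "L = (\<lambda>(a, b). - (of_nat b ^ m / of_nat a ^ Suc m) * Ln (1 - x ^ a * y ^ b))"
  note X = polylog_has_sum [OF x, of "Suc m"] and Y = power_moment_has_sum [OF y, of m]
  have F_abs: "(\<lambda>t. norm (F t)) summable_on {0<..} \<times> {0<..}"
  proof -
    have "norm (F (p, q)) = norm (x ^ p / of_nat p ^ Suc m) * norm (of_nat q ^ m * y ^ q)" for p q
      by (simp only: F_def norm_mult prod.case)
    moreover have "(\<lambda>p. norm (norm (x ^ p / of_nat p ^ Suc m)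
        * (\<Sum>\<^sub>\<infinity>q\<in>{0<..}. norm (of_nat q ^ m * y ^ q)))) summable_on {0<..}"
      using summable_on_cmult_left [OF X(2)] by (simp only: real_norm_def abs_mult abs_norm_cancel)
    ultimately show ?thesis
      unfolding Infinite_Sum.abs_summable_on_Sigma_iff
      using summable_on_cmult_right [OF Y(2)] by (simp only: infsum_cmult_right' simp_thms ball_triv)
  qed
  have F: "infsum F ({0<..} \<times> {0<..}) = polylog (of_nat (Suc m)) x * (y * power_moment m y)"
  proof -
    have "infsum F ({0<..} \<times> {0<..})
        = (\<Sum>\<^sub>\<infinity>p\<in>{0<..}. \<Sum>\<^sub>\<infinity>q\<in>{0<..}. F (p, q))"
      using infsum_Sigma_banach [OF abs_summable_summable [OF F_abs]] by simp
    also have "\<dots> = polylog (of_nat (Suc m)) x * (y * power_moment m y)"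
      using infsumI [OF X(1)] infsumI [OF Y(1)]
      by (simp only: F_def prod.case infsum_cmult_right' infsum_cmult_left')
    finally show ?thesis .
  qed
  have G_abs: "(\<lambda>t. norm (G t)) summable_on coprime_pairs \<times> {0<..}"
    unfolding G_def
    using summable_on_reindex_bij_betw [OF bij_betw_coprime_pairs_scale, of "\<lambda>t. norm (F t)"] F_abs
    by (simp only:)
  have L: "((\<lambda>k. G (ab, k)) has_sum L ab) {0<..}" if ab_in: "ab \<in> coprime_pairs" for ab
  proof -
    obtain a b where ab: "ab = (a, b)" and pos: "a > 0" "b > 0"
      using ab_in by (auto simp: coprime_pairs_def)
    have "norm (x ^ a * y ^ b) < 1"
    proof -
      have "norm x ^ a < 1" "norm y ^ b < 1"
        using x y pos by (simp_all add: power_less_one_iff)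
      then show ?thesis
        using mult_strict_mono' [of "norm x ^ a" 1 "norm y ^ b" 1] by (simp add: norm_mult norm_power)
    qed
    from has_sum_cmult_right [OF neg_Ln_one_minus_has_sum [OF this], of "of_nat b ^ m / of_nat a ^ Suc m"]
    have "((\<lambda>k. of_nat b ^ m / of_nat a ^ Suc m * ((x ^ a * y ^ b) ^ k / of_nat k))
        has_sum L ab) {0<..}"
      by (simp add: L_def ab)
    \<comment> \<open>In \<open>(k * b) ^ m / (k * a) ^ Suc m\<close> the powers of \<open>k\<close>
      cancel down to the \<open>1 / k\<close> of the logarithmic series.\<close>
    moreover have "of_nat b ^ m / of_nat a ^ Suc m * ((x ^ a * y ^ b) ^ k / of_nat k) = G (ab, k)"
      if "k \<in> {0<..}" for k
      using that pos
      by (simp add: G_def F_def ab power_mult_distrib power_mult [symmetric] field_simps)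
    ultimately show ?thesis by (rule has_sum_cong [THEN iffD1, rotated])
  qed
  \<comment> \<open>By the triangle inequality \<open>norm (L ab)\<close> is at most the sum of
    \<open>norm (G (ab, k))\<close> over \<open>k\<close>, and absolute summability of
    \<open>G\<close> makes these sums summable over \<open>ab\<close>.\<close>
  have L_abs: "(\<lambda>t. norm (L t)) summable_on coprime_pairs"
  proof (rule Infinite_Sum.abs_summable_on_comparison_test)
    show "(\<lambda>ab. norm (\<Sum>\<^sub>\<infinity>k\<in>{0<..}. norm (G (ab, k)))) summable_on coprime_pairs"
      using G_abs by (simp add: Infinite_Sum.abs_summable_on_Sigma_iff)
  next
    fix ab assume ab: "ab \<in> coprime_pairs"
    then have "(\<lambda>k. norm (G (ab, k))) summable_on {0<..}"
      using G_abs by (simp add: Infinite_Sum.abs_summable_on_Sigma_iff)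
    from norm_infsum_bound [OF this] infsumI [OF L [OF ab]]
    show "norm (L ab) \<le> norm (\<Sum>\<^sub>\<infinity>k\<in>{0<..}. norm (G (ab, k)))"
      by simp
  qed
  have "infsum L coprime_pairs = (\<Sum>\<^sub>\<infinity>ab\<in>coprime_pairs. \<Sum>\<^sub>\<infinity>k\<in>{0<..}. G (ab, k))"
    by (intro infsum_cong) (simp add: infsumI [OF L])
  also have "\<dots> = infsum G (coprime_pairs \<times> {0<..})"
    using infsum_Sigma_banach [OF abs_summable_summable [OF G_abs]] by simp
  also have "\<dots> = infsum F ({0<..} \<times> {0<..})"
    unfolding G_def by (rule infsum_reindex_bij_betw [OF bij_betw_coprime_pairs_scale])
  finally have "infsum L coprime_pairs = polylog (of_nat (Suc m)) x * (y * power_moment m y)"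
    by (simp only: F)
  with L_abs show ?thesis
    by (simp add: has_coprime_prod_def L_def case_prod_unfold)
qed

theorem theorem1p2:
  fixes x y :: complex
  assumes "norm x < 1" and "norm y < 1"
  shows "has_coprime_prod x y (\<lambda>a b. - (1 / of_nat a))
           (exp (- (y / (1 - y)) * Ln (1 - x))) \<and>
         has_coprime_prod x y (\<lambda>a b. - (of_nat b / of_nat a ^ 2))
           (exp (polylog 2 x * (y / (1 - y) ^ 2))) \<and>
         has_coprime_prod x y (\<lambda>a b. - (of_nat b ^ 2 / of_nat a ^ 3))
           (exp (polylog 3 x * (y * (1 + y) / (1 - y) ^ 3))) \<and>
         has_coprime_prod x y (\<lambda>a b. - (of_nat b ^ 3 / of_nat a ^ 4))
           (exp (polylog 4 x * (y * (1 + 4 * y + y ^ 2) / (1 - y) ^ 4))) \<and>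
         has_coprime_prod x y (\<lambda>a b. - (of_nat b ^ 4 / of_nat a ^ 5))
           (exp (polylog 5 x * (y * (1 + y) * (1 + 10 * y + y ^ 2) / (1 - y) ^ 5)))"
proof -
  note prod = has_coprime_prod_polylog [OF assms] and moment = power_moment_closed_forms [OF assms(2)]
  show ?thesis
    \<comment> \<open>The five products are the cases \<open>m = 0\<close> to \<open>4\<close>; for
      \<open>m = 0\<close> the polylogarithm is \<open>- Ln (1 - x)\<close>.\<close>
    using prod [of 0] prod [of 1] prod [of 2] prod [of 3] prod [of 4]
    by (simp add: moment moment(2) [simplified] polylog_1 [OF assms(1)] power2_eq_square mult.commute
        mult.assoc)
qed

end
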